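(* Let $A$ be a two-sided brace and let $X\subseteq A$ be a subset such that the restriction $r=r_A|_{X\times X}$ gives a non-degenerate solution $(X,r)$ to the Yang--Baxter equation. Let $g_1,\dots,g_n\in\mathbb{C}$ and let $f_1,\dots,f_n\colon X\to X$ be $\mathcal{G}(X,r)$-equivariant maps. Let $V=\mathbb{C}X$ be the complex vector space with basis the elements of $X$, and denote by $\oplus$ the addition of $V$. Let $k\colon V\to V$ be defined by $$k(x)=f_1(x)\cdot g_1\oplus f_2(x)\cdot g_2\oplus\cdots\oplus f_n(x)\cdot g_n$$ for $x\in X$ and then extended by linearity to $V$. If $k$ is involutive (i.e. $k^2=\mathrm{id}$), then $K(u)=uk$ satisfies the reflection equation $$K_{2}(v)R(u+v)K_{2}(u)R(u-v)=R(u-v)K_{2}(u)R(u+v)K_{2}(v)$$ for all $u,v\in\mathbb{C}$, where $R(u)=\mathrm{id}+ur$ and $K_2(u)=\mathrm{id}\otimes K(u)$ on $V\otimes V$.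
   Context: A left brace is a triple $(A,+,\circ)$ such that $(A,+)$ is an abelian group, $(A,\circ)$ is a group and $a\circ(b+c)=a\circ b-a+a\circ c$ for all $a,b,c\in A$; it is two-sided if also $(a+b)\circ c=a\circ c-c+b\circ c$ for all $a,b,c\in A$. Put $\lambda_a(b)=-a+a\circ b$, write $x'$ for the inverse of $x$ in $(A,\circ)$, and put $\mu_b(a)=\lambda_a(b)'\circ a\circ b$. The map $r_A(a,b)=(\lambda_a(b),\mu_b(a))$ is an involutive non-degenerate solution to the Yang--Baxter equation (YBE) on $A$. A solution to the YBE is a pair $(X,r)$ with $r\colon X\times X\to X\times X$ bijective satisfying $(r\times\mathrm{id})(\mathrm{id}\times r)(r\times\mathrm{id})=(\mathrm{id}\times r)(r\times\mathrm{id})(\mathrm{id}\times r)$; writing $r(x,y)=(\sigma_x(y),\tau_y(x))$, it is non-degenerate if all $\sigma_x,\tau_x\colon X\to X$ are bijective, involutive if $r^2=\mathrm{id}$. For $(X,r)$ involutive and non-degenerate, $\mathcal{G}(X,r)$ is the group of permutations of $X$ generated by $\{\sigma_x:x\in X\}$, and $f\colon X\to X$ is $\mathcal{G}(X,r)$-equivariant if $f\sigma_x=\sigma_xf$ for all $x\in X$. For $r=r_A|_{X\times X}$, $\sigma_x=\lambda_x|_X$ and $\tau_x=\mu_x|_X$. On $V\otimes V$, the letter $r$ also denotes the linear map with $r(x\otimes y)=\sigma_x(y)\otimes\tau_y(x)$ for $x,y\in X$. Here $f_i(x)\cdot g_i$ is the basis vector $f_i(x)\in X$ multiplied by the scalar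 $g_i$. *)

theory Defs
  imports Complex_Main "HOL-Library.Poly_Mapping"
begin

text \<open>The additive group of the brace is the one of the type class; \<open>e\<close> and \<open>cinv\<close> are the neutral
  element and the inversion of the multiplicative group.\<close>

locale left_brace = group circ e cinv
  for circ :: "'a::ab_group_add \<Rightarrow> 'a \<Rightarrow> 'a" and e :: 'a and cinv :: "'a \<Rightarrow> 'a" +
  assumes circ_add: "circ a (b + c) = circ a b - a + circ a c"

locale two_sided_brace = left_brace +
  assumes add_circ: "circ (a + b) c = circ a c - c + circ b c"

definition brace_lambda :: "('a::ab_group_add \<Rightarrow> 'a \<Rightarrow> 'a) \<Rightarrow> 'a \<Rightarrow> 'a \<Rightarrow> 'a" where
  "brace_lambda circ a b = - a + circ a b"

text \<open>Note the order of the arguments: \<open>brace_mu circ cinv b a\<close> is $\mu_b(a)$.\<close>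

definition brace_mu :: "('a::ab_group_add \<Rightarrow> 'a \<Rightarrow> 'a) \<Rightarrow> ('a \<Rightarrow> 'a) \<Rightarrow> 'a \<Rightarrow> 'a \<Rightarrow> 'a" where
  "brace_mu circ cinv b a = circ (circ (cinv (brace_lambda circ a b)) a) b"

definition brace_r :: "('a::ab_group_add \<Rightarrow> 'a \<Rightarrow> 'a) \<Rightarrow> ('a \<Rightarrow> 'a) \<Rightarrow> 'a \<times> 'a \<Rightarrow> 'a \<times> 'a" where
  "brace_r circ cinv = (\<lambda>(a, b). (brace_lambda circ a b, brace_mu circ cinv b a))"

text \<open>A solution on a set \<open>X\<close> is given by a function on the whole type, of which only the
  restriction to \<open>X \<times> X\<close> is ever used. As usual, \<open>r (x, y) = (sol_sigma r x y, sol_tau r y x)\<close>.\<close>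

definition sol_sigma :: "('a \<times> 'a \<Rightarrow> 'a \<times> 'a) \<Rightarrow> 'a \<Rightarrow> 'a \<Rightarrow> 'a" where
  "sol_sigma r x y = fst (r (x, y))"

definition sol_tau :: "('a \<times> 'a \<Rightarrow> 'a \<times> 'a) \<Rightarrow> 'a \<Rightarrow> 'a \<Rightarrow> 'a" where
  "sol_tau r y x = snd (r (x, y))"

definition r_times_id :: "('a \<times> 'a \<Rightarrow> 'a \<times> 'a) \<Rightarrow> 'a \<times> 'a \<times> 'a \<Rightarrow> 'a \<times> 'a \<times> 'a" where
  "r_times_id r = (\<lambda>(x, y, z). (fst (r (x, y)), snd (r (x, y)), z))"

definition id_times_r :: "('a \<times> 'a \<Rightarrow> 'a \<times> 'a) \<Rightarrow> 'a \<times> 'a \<times> 'a \<Rightarrow> 'a \<times> 'a \<times> 'a" where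
  "id_times_r r = (\<lambda>(x, y, z). (x, r (y, z)))"

definition ybe_solution :: "'a set \<Rightarrow> ('a \<times> 'a \<Rightarrow> 'a \<times> 'a) \<Rightarrow> bool" where
  "ybe_solution X r \<longleftrightarrow>
     bij_betw r (X \<times> X) (X \<times> X) \<and>
     (\<forall>t \<in> X \<times> X \<times> X.
        (r_times_id r \<circ> id_times_r r \<circ> r_times_id r) t =
        (id_times_r r \<circ> r_times_id r \<circ> id_times_r r) t)"

definition nondegenerate :: "'a set \<Rightarrow> ('a \<times> 'a \<Rightarrow> 'a \<times> 'a) \<Rightarrow> bool" where
  "nondegenerate X r \<longleftrightarrow>
     (\<forall>x\<in>X. bij_betw (sol_sigma r x) X X \<and> bij_betw (sol_tau r x) X X)"

definition equivariant_map :: "'a set \<Rightarrow> ('a \<times> 'a \<Rightarrow> 'a \<times> 'a) \<Rightarrow> ('a \<Rightarrow> 'a) \<Rightarrow> bool" where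
  "equivariant_map X r f \<longleftrightarrow>
     f ` X \<subseteq> X \<and> (\<forall>x\<in>X. \<forall>y\<in>X. f (sol_sigma r x y) = sol_sigma r x (f y))"

text \<open>The space $\mathbb{C}X$ consists of the finitely supported functions with support in \<open>X\<close>.\<close>

definition free_space :: "'a set \<Rightarrow> ('a \<Rightarrow>\<^sub>0 complex) set" where
  "free_space X = {p. Poly_Mapping.keys p \<subseteq> X}"

definition cscale :: "complex \<Rightarrow> ('a \<Rightarrow>\<^sub>0 complex) \<Rightarrow> ('a \<Rightarrow>\<^sub>0 complex)" where
  "cscale c = Poly_Mapping.map ((*) c)"

definition basis_vec :: "'a \<Rightarrow> ('a \<Rightarrow>\<^sub>0 complex)" where
  "basis_vec x = Poly_Mapping.single x 1"

definition lin_ext :: "('a \<Rightarrow> ('b \<Rightarrow>\<^sub>0 complex)) \<Rightarrow> ('a \<Rightarrow>\<^sub>0 complex) \<Rightarrow> ('b \<Rightarrow>\<^sub>0 complex)" where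
  "lin_ext \<phi> p = (\<Sum>x\<in>Poly_Mapping.keys p. cscale (Poly_Mapping.lookup p x) (\<phi> x))"

text \<open>$\mathbb{C}X \otimes \mathbb{C}Y$ is modelled by $\mathbb{C}(X \times Y)$, the elementary tensor
  $x \otimes y$ of basis vectors being the basis vector \<open>(x, y)\<close>.\<close>

definition tensor :: "('a \<Rightarrow>\<^sub>0 complex) \<Rightarrow> ('b \<Rightarrow>\<^sub>0 complex) \<Rightarrow> ('a \<times> 'b \<Rightarrow>\<^sub>0 complex)" where
  "tensor p q = lin_ext (\<lambda>x. lin_ext (\<lambda>y. basis_vec (x, y)) q) p"

definition tensor_map ::
    "(('a \<Rightarrow>\<^sub>0 complex) \<Rightarrow> ('c \<Rightarrow>\<^sub>0 complex)) \<Rightarrow> (('b \<Rightarrow>\<^sub>0 complex) \<Rightarrow> ('d \<Rightarrow>\<^sub>0 complex)) \<Rightarrow>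
     ('a \<times> 'b \<Rightarrow>\<^sub>0 complex) \<Rightarrow> ('c \<times> 'd \<Rightarrow>\<^sub>0 complex)" where
  "tensor_map F G = lin_ext (\<lambda>(x, y). tensor (F (basis_vec x)) (G (basis_vec y)))"

lemma lookup_cscale [simp]: "Poly_Mapping.lookup (cscale c p) x = c * Poly_Mapping.lookup p x"
  by (simp add: cscale_def map.rep_eq when_def)

interpretation cvs: vector_space cscale
  by unfold_locales (auto intro!: poly_mapping_eqI simp: lookup_add algebra_simps)

lemma lin_ext_superset:
  assumes "finite S" "Poly_Mapping.keys p \<subseteq> S"
  shows "lin_ext \<phi> p = (\<Sum>x\<in>S. cscale (Poly_Mapping.lookup p x) (\<phi> x))"
  unfolding lin_ext_def
  by (rule sum.mono_neutral_left) (use assms in \<open>auto simp: in_keys_iff\<close>)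

lemma linear_lin_ext: "Vector_Spaces.linear cscale cscale (lin_ext \<phi>)"
proof -
  have add: "lin_ext \<phi> (p + q) = lin_ext \<phi> p + lin_ext \<phi> q" for p q
    using keys_add [of p q]
    by (simp add: lin_ext_superset [of "Poly_Mapping.keys p \<union> Poly_Mapping.keys q"]
        lookup_add cvs.scale_left_distrib sum.distrib)
  have scale: "lin_ext \<phi> (cscale c p) = cscale c (lin_ext \<phi> p)" for c p
  proof -
    have "Poly_Mapping.keys (cscale c p) \<subseteq> Poly_Mapping.keys p"
      by (auto simp: in_keys_iff)
    then show ?thesis
      by (simp add: lin_ext_superset [of "Poly_Mapping.keys p"] cvs.scale_sum_right)
  qed
  show ?thesis
    by unfold_locales (fact add, fact scale)
qed

lemma lin_ext_basis_vec [simp]: "lin_ext \<phi> (basis_vec x) = \<phi> x"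
  by (simp add: lin_ext_def basis_vec_def)

lemma tensor_basis_vec: "tensor (basis_vec x) (basis_vec y) = basis_vec (x, y)"
  by (simp add: tensor_def)

lemma lookup_tensor:
  "Poly_Mapping.lookup (tensor p q) (x, y) = Poly_Mapping.lookup p x * Poly_Mapping.lookup q y"
proof -
  have inner: "Poly_Mapping.lookup (lin_ext (\<lambda>y. basis_vec (z, y)) q) (x, y) =
      (if z = x then Poly_Mapping.lookup q y else 0)"
    for z
    by (cases "y \<in> Poly_Mapping.keys q")
      (auto simp: lin_ext_def lookup_sum basis_vec_def lookup_single when_def in_keys_iff
        if_distrib [of "(*) _"] cong: if_cong)
  show ?thesis
    unfolding tensor_def
    by (subst lin_ext_def)
      (cases "x \<in> Poly_Mapping.keys p"; auto simp: lookup_sum inner in_keys_iff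
        if_distrib [of "(*) _"] cong: if_cong)
qed

lemma linear_eq_lin_ext:
  assumes "Vector_Spaces.linear cscale cscale F"
  shows "F p = lin_ext (\<lambda>x. F (basis_vec x)) p"
proof -
  interpret F: Vector_Spaces.linear cscale cscale F by fact
  have "p = lin_ext basis_vec p"
    by (rule poly_mapping_eqI)
      (auto simp: lin_ext_def lookup_sum basis_vec_def lookup_single when_def in_keys_iff
        if_distrib [of "(*) _"] cong: if_cong)
  then have "F p = F (\<Sum>x\<in>Poly_Mapping.keys p. cscale (Poly_Mapping.lookup p x) (basis_vec x))"
    by (simp add: lin_ext_def)
  then show ?thesis
    by (simp add: lin_ext_def F.sum F.scale)
qed

lemma tensor_map_tensor:
  assumes "Vector_Spaces.linear cscale cscale F" "Vector_Spaces.linear cscale cscale G"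
  shows "tensor_map F G (tensor p q) = tensor (F p) (G q)"
proof -
  interpret L: Vector_Spaces.linear cscale cscale "tensor_map F G"
    unfolding tensor_map_def by (rule linear_lin_ext)
  have l: "tensor (\<Sum>x\<in>S. cscale (c x) (P x)) Q = (\<Sum>x\<in>S. cscale (c x) (tensor (P x) Q))"
    for S :: "'i set" and c P and Q :: "'j \<Rightarrow>\<^sub>0 complex"
    by (rule poly_mapping_eqI) (auto simp: lookup_tensor lookup_sum sum_distrib_left algebra_simps)
  have r: "tensor P (\<Sum>x\<in>S. cscale (c x) (Q x)) = (\<Sum>x\<in>S. cscale (c x) (tensor P (Q x)))"
    for S :: "'i set" and c Q and P :: "'j \<Rightarrow>\<^sub>0 complex"
    by (rule poly_mapping_eqI) (auto simp: lookup_tensor lookup_sum sum_distrib_left algebra_simps)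
  have "tensor_map F G (basis_vec (x, y)) = tensor (F (basis_vec x)) (G (basis_vec y))" for x y
    by (simp add: tensor_map_def)
  then have "tensor_map F G (tensor p q) =
      (\<Sum>x\<in>Poly_Mapping.keys p. cscale (Poly_Mapping.lookup p x)
         (\<Sum>y\<in>Poly_Mapping.keys q. cscale (Poly_Mapping.lookup q y)
         (tensor (F (basis_vec x)) (G (basis_vec y)))))"
    by (simp add: tensor_def [of p q] lin_ext_def L.sum L.scale)
  also have "\<dots> = tensor (F p) (G q)"
    unfolding linear_eq_lin_ext [OF assms(1), of p] linear_eq_lin_ext [OF assms(2), of q]
      lin_ext_def l
    by (simp only: r)
  finally show ?thesis .
qed

definition r_lin :: "('a \<times> 'a \<Rightarrow> 'a \<times> 'a) \<Rightarrow> ('a \<times> 'a \<Rightarrow>\<^sub>0 complex) \<Rightarrow> ('a \<times> 'a \<Rightarrow>\<^sub>0 complex)" where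
  "r_lin r = lin_ext (\<lambda>(x, y). tensor (basis_vec (sol_sigma r x y)) (basis_vec (sol_tau r y x)))"

definition R_op ::
    "('a \<times> 'a \<Rightarrow> 'a \<times> 'a) \<Rightarrow> complex \<Rightarrow> ('a \<times> 'a \<Rightarrow>\<^sub>0 complex) \<Rightarrow> ('a \<times> 'a \<Rightarrow>\<^sub>0 complex)" where
  "R_op r u w = w + cscale u (r_lin r w)"

definition K2_op ::
    "(complex \<Rightarrow> ('a \<Rightarrow>\<^sub>0 complex) \<Rightarrow> ('a \<Rightarrow>\<^sub>0 complex)) \<Rightarrow>
     complex \<Rightarrow> ('a \<times> 'a \<Rightarrow>\<^sub>0 complex) \<Rightarrow> ('a \<times> 'a \<Rightarrow>\<^sub>0 complex)" where
  "K2_op K u = tensor_map id (K u)"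

definition reflection_equation ::
    "'a set \<Rightarrow> ('a \<times> 'a \<Rightarrow> 'a \<times> 'a) \<Rightarrow> (complex \<Rightarrow> ('a \<Rightarrow>\<^sub>0 complex) \<Rightarrow> ('a \<Rightarrow>\<^sub>0 complex)) \<Rightarrow> bool" where
  "reflection_equation X r K \<longleftrightarrow>
     (\<forall>u v. \<forall>w \<in> free_space (X \<times> X).
        (K2_op K v \<circ> R_op r (u + v) \<circ> K2_op K u \<circ> R_op r (u - v)) w =
        (R_op r (u - v) \<circ> K2_op K u \<circ> R_op r (u + v) \<circ> K2_op K v) w)"

end

theory Submission
  imports Defs
begin

text \<open>Since $k^2 = \mathrm{id}$, expanding both sides of the reflection equation in powers of
  \<open>r\<close> and \<open>K = id \<otimes> k\<close> reduces it to \<open>K r K r = r K r K\<close>. On a basis vector \<open>(x, y)\<close> both sides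
  are double sums with coefficients \<open>g i * g j\<close>. The definition of $\mu$ gives
  $\sigma_{\sigma_x(y)}(\tau_y(x)) = x$, so by equivariance the \<open>(i, j)\<close> term on the left is
  $(f_i(x), \sigma_{f_i(x)}^{-1}\sigma_x f_j(y))$, which is the \<open>(j, i)\<close> term on the right.\<close>

lemma brace_lambda_mu:
  assumes "group circ e cinv"
  shows "sol_sigma (brace_r circ cinv) (sol_sigma (brace_r circ cinv) x y)
           (sol_tau (brace_r circ cinv) y x) = x"
proof -
  interpret group circ e cinv by fact
  have "circ c (circ (circ (cinv c) x) y) = circ x y" for c
    by (simp add: assoc [symmetric])
  then show ?thesis
    by (simp add: sol_sigma_def sol_tau_def brace_r_def brace_mu_def brace_lambda_def)
qed

lemma equivariant_reflection:
  assumes nd: "nondegenerate X r"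
    and st: "\<And>x y. sol_sigma r (sol_sigma r x y) (sol_tau r y x) = x"
    and F: "equivariant_map X r F" and G: "equivariant_map X r G"
    and x: "x \<in> X" and y: "y \<in> X"
  shows "sol_sigma r (sol_sigma r x y) (F (sol_tau r y x)) =
      sol_sigma r (sol_sigma r x (G y)) (F (sol_tau r (G y) x))" (is "?p = ?p'")
    and "G (sol_tau r (F (sol_tau r y x)) (sol_sigma r x y)) =
      sol_tau r (F (sol_tau r (G y) x)) (sol_sigma r x (G y))" (is "?q = ?q'")
proof -
  have s: "sol_sigma r a b \<in> X" and t: "sol_tau r a b \<in> X" if "a \<in> X" "b \<in> X" for a b
    using nd that by (auto simp: nondegenerate_def bij_betw_def)
  have FX: "F a \<in> X" and GX: "G a \<in> X" if "a \<in> X" for a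
    using F G that by (auto simp: equivariant_map_def)
  have Fs: "sol_sigma r a (F b) = F (sol_sigma r a b)"
    and Gs: "sol_sigma r a (G b) = G (sol_sigma r a b)" if "a \<in> X" "b \<in> X" for a b
    using F G that by (auto simp: equivariant_map_def)
  have p: "sol_sigma r (sol_sigma r x z) (F (sol_tau r z x)) = F x" if "z \<in> X" for z
    using that x by (simp add: Fs s t st)
  show "?p = ?p'"
    using y by (simp add: p GX)
  have st': "sol_sigma r (F x) (sol_tau r (F (sol_tau r z x)) (sol_sigma r x z)) = sol_sigma r x z"
    if "z \<in> X" for z
    using st [of "sol_sigma r x z" "F (sol_tau r z x)"] by (simp add: p that)
  have "sol_sigma r (F x) ?q = sol_sigma r x (G y)"
    using x y by (simp add: Gs FX s t st')
  also have "\<dots> = sol_sigma r (F x) ?q'"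
    using y by (simp add: st' GX)
  finally have "sol_sigma r (F x) ?q = sol_sigma r (F x) ?q'" .
  moreover have "inj_on (sol_sigma r (F x)) X"
    using nd FX [OF x] by (auto simp: nondegenerate_def bij_betw_def)
  ultimately show "?q = ?q'"
    using x y by (simp add: inj_on_eq_iff FX GX s t)
qed

lemma linear_eq_on_free_space:
  assumes "Vector_Spaces.linear cscale cscale F" "Vector_Spaces.linear cscale cscale G"
    and "\<And>x. x \<in> X \<Longrightarrow> F (basis_vec x) = G (basis_vec x)" and "p \<in> free_space X"
  shows "F p = G p"
  unfolding linear_eq_lin_ext [OF assms(1), of p] linear_eq_lin_ext [OF assms(2), of p] lin_ext_def
  using assms(3,4) by (auto simp: free_space_def intro!: sum.cong)

lemma tensor_sum_right: "tensor P (\<Sum>i\<in>S. cscale (c i) (Q i)) = (\<Sum>i\<in>S. cscale (c i) (tensor P (Q i)))"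
  by (rule poly_mapping_eqI) (auto simp: lookup_tensor lookup_sum sum_distrib_left algebra_simps)

lemma tensor_cscale_right: "tensor P (cscale c Q) = cscale c (tensor P Q)"
  by (rule poly_mapping_eqI) (auto simp: lookup_tensor algebra_simps)

lemma lin_ext_cscale: "lin_ext (\<lambda>x. cscale c (\<phi> x)) p = cscale c (lin_ext \<phi> p)"
  by (simp add: lin_ext_def cvs.scale_sum_right mult.commute)

lemma K2_op_cscale: "K2_op (\<lambda>u p. cscale u (k p)) u w = cscale u (tensor_map id k w)"
  by (simp add: K2_op_def tensor_map_def tensor_cscale_right lin_ext_cscale case_prod_unfold)

text \<open>Passes from the parameter-free equation \<open>const\<close> to the one with spectral
  parameters. Expanding, the \<open>K S K\<close> terms carry \<open>u + v\<close> on both sides,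
  \<open>K K S\<close> and \<open>S K K\<close> carry \<open>u - v\<close>, and the quartic words
  carry the product of the two.\<close>

lemma reflection_equation_if_constant:
  fixes r :: "'a \<times> 'a \<Rightarrow> 'a \<times> 'a" and k :: "('a \<Rightarrow>\<^sub>0 complex) \<Rightarrow> ('a \<Rightarrow>\<^sub>0 complex)"
  assumes lin: "Vector_Spaces.linear cscale cscale k"
    and inv: "\<And>p. p \<in> free_space X \<Longrightarrow> k (k p) = p"
    and const: "\<And>x y. x \<in> X \<Longrightarrow> y \<in> X \<Longrightarrow>
      tensor_map id k (r_lin r (tensor_map id k (r_lin r (basis_vec (x, y))))) =
      r_lin r (tensor_map id k (r_lin r (tensor_map id k (basis_vec (x, y)))))"
    and closed: "r ` (X \<times> X) \<subseteq> X \<times> X"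
  shows "reflection_equation X r (\<lambda>u p. cscale u (k p))"
proof -
  define K :: "('a \<times> 'a \<Rightarrow>\<^sub>0 complex) \<Rightarrow> ('a \<times> 'a \<Rightarrow>\<^sub>0 complex)" where "K = tensor_map id k"
  define S where "S = r_lin r"
  have linK: "Vector_Spaces.linear cscale cscale K"
    unfolding K_def tensor_map_def by (rule linear_lin_ext)
  have linS: "Vector_Spaces.linear cscale cscale S"
    unfolding S_def r_lin_def by (rule linear_lin_ext)
  note lin_comp = Vector_Spaces.linear_compose [unfolded comp_def]
  interpret K: Vector_Spaces.linear cscale cscale K by (fact linK)
  interpret S: Vector_Spaces.linear cscale cscale S by (fact linS)
  have KK_basis: "K (K (basis_vec (x, y))) = basis_vec (x, y)" if "y \<in> X" for x y
  proof -
    have "K (K (basis_vec (x, y))) = tensor (basis_vec x) (k (k (basis_vec y)))"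
      by (simp add: K_def tensor_map_tensor [OF cvs.linear_id lin] tensor_basis_vec [symmetric])
    also have "k (k (basis_vec y)) = basis_vec y"
      using that by (intro inv) (simp add: free_space_def basis_vec_def)
    finally show ?thesis
      by (simp add: tensor_basis_vec)
  qed
  have KK: "K (K w) = w" if "w \<in> free_space (X \<times> X)" for w
    by (rule linear_eq_on_free_space [OF lin_comp [OF linK linK] cvs.linear_ident _ that])
      (auto simp: KK_basis)
  \<comment> \<open>\<open>K\<close> is known to square to the identity only over \<open>X\<close>,
    so \<open>closed\<close> is needed to keep \<open>S\<close> of a basis vector there.\<close>
  have KKS: "K (K (S w)) = S w" if "w \<in> free_space (X \<times> X)" for w
  proof (rule linear_eq_on_free_space [OF lin_comp [OF linS lin_comp [OF linK linK]] linS _ that])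
    fix z assume "z \<in> X \<times> X"
    with closed have "r z \<in> X \<times> X" by blast
    then have "snd (r z) \<in> X" by (simp add: mem_Times_iff)
    then show "K (K (S (basis_vec z))) = S (basis_vec z)"
      using KK_basis [of "snd (r z)" "fst (r z)"]
      by (simp add: S_def r_lin_def tensor_basis_vec sol_sigma_def sol_tau_def case_prod_unfold)
  qed
  have KSKS: "K (S (K (S w))) = S (K (S (K w)))" if "w \<in> free_space (X \<times> X)" for w
    by (rule linear_eq_on_free_space [OF
          lin_comp [OF linS lin_comp [OF linK lin_comp [OF linS linK]]]
          lin_comp [OF linK lin_comp [OF linS lin_comp [OF linK linS]]] _ that])
      (auto simp: const K_def S_def)
  show ?thesis
    unfolding reflection_equation_def
  proof (intro allI ballI)
    fix u v w assume w: "w \<in> free_space (X \<times> X)"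
    show "(K2_op (\<lambda>u p. cscale u (k p)) v \<circ> R_op r (u + v) \<circ> K2_op (\<lambda>u p. cscale u (k p)) u
          \<circ> R_op r (u - v)) w =
        (R_op r (u - v) \<circ> K2_op (\<lambda>u p. cscale u (k p)) u \<circ> R_op r (u + v)
          \<circ> K2_op (\<lambda>u p. cscale u (k p)) v) w"
      \<comment> \<open>Both sides become \<open>u * v\<close> times the sum of \<open>w\<close>,
        \<open>(u - v)\<close> times \<open>S w\<close>, \<open>(u + v)\<close> times
        \<open>K (S (K w))\<close>, and \<open>(u + v) * (u - v)\<close> times
        \<open>S (K (S (K w)))\<close>.\<close>
      by (simp add: K2_op_cscale R_op_def K_def [symmetric] S_def [symmetric]
          K.add S.add K.scale S.scale KK [OF w] KKS [OF w] KSKS [OF w])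
        (rule poly_mapping_eqI, simp add: lookup_add algebra_simps)
  qed
qed

theorem theorem5p6:
  fixes circ :: "'a::ab_group_add \<Rightarrow> 'a \<Rightarrow> 'a" and e :: 'a and cinv :: "'a \<Rightarrow> 'a"
    and X :: "'a set" and n :: nat
    and g :: "nat \<Rightarrow> complex" and f :: "nat \<Rightarrow> 'a \<Rightarrow> 'a"
    and r :: "'a \<times> 'a \<Rightarrow> 'a \<times> 'a"
    and k :: "('a \<Rightarrow>\<^sub>0 complex) \<Rightarrow> ('a \<Rightarrow>\<^sub>0 complex)"
  defines "r \<equiv> brace_r circ cinv"
    and "k \<equiv> lin_ext (\<lambda>x. \<Sum>i\<in>{1..n}. cscale (g i) (basis_vec (f i x)))"
  assumes "two_sided_brace circ e cinv"
    and "ybe_solution X r" and "nondegenerate X r"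
    and "\<And>i. i \<in> {1..n} \<Longrightarrow> equivariant_map X r (f i)"
    and "\<And>p. p \<in> free_space X \<Longrightarrow> k (k p) = p"
  shows "reflection_equation X r (\<lambda>u p. cscale u (k p))"
proof -
  interpret B: two_sided_brace circ e cinv by fact
  have st: "sol_sigma r (sol_sigma r x y) (sol_tau r y x) = x" for x y
    unfolding r_def by (rule brace_lambda_mu) (fact B.group_axioms)
  have link: "Vector_Spaces.linear cscale cscale k"
    unfolding k_def by (rule linear_lin_ext)
  define K :: "('a \<times> 'a \<Rightarrow>\<^sub>0 complex) \<Rightarrow> ('a \<times> 'a \<Rightarrow>\<^sub>0 complex)" where "K = tensor_map id k"
  define S where "S = r_lin r"
  interpret K: Vector_Spaces.linear cscale cscale K
    unfolding K_def tensor_map_def by (rule linear_lin_ext)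
  interpret S: Vector_Spaces.linear cscale cscale S
    unfolding S_def r_lin_def by (rule linear_lin_ext)
  have Kb: "K (basis_vec (x, y)) = (\<Sum>i\<in>{1..n}. cscale (g i) (basis_vec (x, f i y)))" for x y
    by (simp add: K_def tensor_map_def k_def tensor_sum_right tensor_basis_vec)
  have Sb: "S (basis_vec (x, y)) = basis_vec (sol_sigma r x y, sol_tau r y x)" for x y
    by (simp add: S_def r_lin_def tensor_basis_vec)
  have KSKS: "K (S (K (S (basis_vec (x, y))))) = S (K (S (K (basis_vec (x, y)))))"
    if x: "x \<in> X" and y: "y \<in> X" for x y
  proof -
    have "K (S (K (S (basis_vec (x, y))))) = (\<Sum>i\<in>{1..n}. \<Sum>j\<in>{1..n}. cscale (g i * g j)
        (basis_vec (sol_sigma r (sol_sigma r x y) (f i (sol_tau r y x)),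
           f j (sol_tau r (f i (sol_tau r y x)) (sol_sigma r x y)))))"
      by (simp add: Kb Sb K.sum S.sum K.scale S.scale cvs.scale_sum_right)
    also have "\<dots> = (\<Sum>i\<in>{1..n}. \<Sum>j\<in>{1..n}. cscale (g i * g j)
        (basis_vec (sol_sigma r (sol_sigma r x (f j y)) (f i (sol_tau r (f j y) x)),
           sol_tau r (f i (sol_tau r (f j y) x)) (sol_sigma r x (f j y)))))"
    proof (intro sum.cong refl)
      fix i j assume "i \<in> {1..n}" "j \<in> {1..n}"
      note eq = equivariant_reflection [OF \<open>nondegenerate X r\<close> st assms(6) [OF this(1)]
          assms(6) [OF this(2)] x y]
      show "cscale (g i * g j)
          (basis_vec (sol_sigma r (sol_sigma r x y) (f i (sol_tau r y x)),
             f j (sol_tau r (f i (sol_tau r y x)) (sol_sigma r x y)))) =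
        cscale (g i * g j)
          (basis_vec (sol_sigma r (sol_sigma r x (f j y)) (f i (sol_tau r (f j y) x)),
             sol_tau r (f i (sol_tau r (f j y) x)) (sol_sigma r x (f j y))))"
        by (simp only: eq)
    qed
    \<comment> \<open>In this word \<open>f j\<close> comes from the \<open>K\<close> applied first,
      so expansion puts \<open>j\<close> in the outer sum. Hence the swap, and commutativity of the
      coefficients.\<close>
    also have "\<dots> = S (K (S (K (basis_vec (x, y)))))"
      by (subst sum.swap)
        (simp add: Kb Sb K.sum S.sum K.scale S.scale cvs.scale_sum_right mult.commute)
    finally show ?thesis .
  qed
  show ?thesis
  proof (rule reflection_equation_if_constant [OF link assms(7)])
    show "r ` (X \<times> X) \<subseteq> X \<times> X"
      using \<open>ybe_solution X r\<close> by (simp add: ybe_solution_def bij_betw_def)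
  qed (use KSKS in \<open>simp_all add: K_def S_def\<close>)
qed

end
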